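(* Let $\{\phi_i\}_{i\in I}$ and $\{\psi_i\}_{i\in I}$ be two woven frames for $\mathcal H$. Then for any $\lambda\in\mathbb R$, all $\sigma\subset I$ and all $f\in\mathcal H$, $$\begin{aligned} &\sum_{i\in\sigma}|\langle f,\phi_i\rangle|^2+\sum_{i\in\sigma}|\langle S_{\mathcal W}^{\sigma^c}f,S_{\mathcal W}^{-1}\phi_i\rangle|^2+\sum_{i\in\sigma^c}|\langle S_{\mathcal W}^{\sigma^c}f,S_{\mathcal W}^{-1}\psi_i\rangle|^2\\ =\ &\sum_{i\in\sigma^c}|\langle f,\psi_i\rangle|^2+\sum_{i\in\sigma}|\langle S_{\mathcal W}^{\sigma}f,S_{\mathcal W}^{-1}\phi_i\rangle|^2+\sum_{i\in\sigma^c}|\langle S_{\mathcal W}^{\sigma}f,S_{\mathcal W}^{-1}\psi_i\rangle|^2\\ \ge\ &\Big(\lambda-\frac{\lambda^2}{4}\Big)\sum_{i\in\sigma}|\langle f,\phi_i\rangle|^2+\Big(1-\frac{\lambda^2}{4}\Big)\sum_{i\in\sigma^c}|\langle f,\psi_i\rangle|^2 . \end{aligned}$$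
   Context: $\mathcal H$ is a separable Hilbert space, $I$ is a countable index set, and for $\sigma\subset I$ one writes $\sigma^c=I\setminus\sigma$. A family $\{\phi_i\}_{i\in I}$ in $\mathcal H$ is a frame with lower and upper frame bounds $A,B>0$ if $A\|f\|^2\le\sum_{i\in I}|\langle f,\phi_i\rangle|^2\le B\|f\|^2$ for all $f\in\mathcal H$. Two frames $\{\phi_i\}_{i\in I}$ and $\{\psi_i\}_{i\in I}$ for $\mathcal H$ are woven if there are universal constants $A,B>0$ such that for every $\sigma\subset I$ the family $\{\phi_i\}_{i\in\sigma}\cup\{\psi_i\}_{i\in\sigma^c}$ (called a weaving) is a frame for $\mathcal H$ with lower and upper bounds $A$ and $B$. For given $\sigma\subset I$, define bounded linear operators on $\mathcal H$ by $S_{\mathcal W}^{\sigma}f=\sum_{i\in\sigma}\langle f,\phi_i\rangle\phi_i$, $S_{\mathcal W}^{\sigma^c}f=\sum_{i\in\sigma^c}\langle f,\psi_i\rangle\psi_i$, and $S_{\mathcal W}=S_{\mathcal W}^{\sigma}+S_{\mathcal W}^{\sigma^c}$; $S_{\mathcal W}$ is the frame operator of the weaving (it depends on $\sigma$), and it is bounded, invertible, self-adjoint and positive. *)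

theory Defs
  imports "HOL-Analysis.Analysis"
begin

text \<open>
  Scalar fields. The two axioms force the field to be a copy of the reals or of the complex
  numbers: \<open>scnj\<close> is an involution fixing the reals, and expanding \<open>(1 + x) * scnj (1 + x)\<close>
  shows that \<open>x + scnj x\<close> is real, so that every \<open>x\<close> is a root of a real quadratic polynomial.
  Working over this class treats real and complex Hilbert spaces at once.
\<close>

class real_or_complex_field = real_normed_field +
  fixes scnj :: "'a \<Rightarrow> 'a"
  assumes scnj_add: "scnj (x + y) = scnj x + scnj y"
    and mult_scnj: "x * scnj x = (norm x)\<^sup>2 *\<^sub>R 1"

instantiation real :: real_or_complex_field
begin

definition scnj_real :: "real \<Rightarrow> real"
  where "scnj_real x = x"

instance
  by standard (simp_all add: scnj_real_def power2_eq_square)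

end

instantiation complex :: real_or_complex_field
begin

definition scnj_complex :: "complex \<Rightarrow> complex"
  where "scnj_complex = cnj"

instance
proof
  fix x y :: complex
  show "scnj (x + y) = scnj x + scnj y"
    by (simp add: scnj_complex_def)
  show "x * scnj x = (norm x)\<^sup>2 *\<^sub>R 1"
    by (simp only: scnj_complex_def complex_norm_square[symmetric] scaleR_conv_of_real mult_1_right)
qed

end

text \<open>
  The inner product is linear in the first argument, which makes
  \<open>f \<mapsto> \<langle>f, \<phi>\<rangle> \<phi>\<close> linear. Completeness comes from the class \<open>banach\<close>.
\<close>

locale hilbert_space = vector_space smul
  for smul :: "'k::real_or_complex_field \<Rightarrow> 'a::banach \<Rightarrow> 'a" +
  fixes ip :: "'a \<Rightarrow> 'a \<Rightarrow> 'k"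
  assumes smul_of_real: "smul (of_real r) x = r *\<^sub>R x"
    and ip_add_left: "ip (x + y) z = ip x z + ip y z"
    and ip_smul_left: "ip (smul c x) y = c * ip x y"
    and ip_commute: "ip y x = scnj (ip x y)"
    and ip_norm: "ip x x = of_real ((norm x)\<^sup>2)"

lemma hilbert_space_real_inner:
  "hilbert_space scaleR (inner :: 'a::{real_inner, banach} \<Rightarrow> 'a \<Rightarrow> real)"
  by standard (simp_all add: algebra_simps scnj_real_def inner_commute power2_norm_eq_inner)

lemma hilbert_space_complex:
  "hilbert_space ((*) :: complex \<Rightarrow> complex \<Rightarrow> complex) (\<lambda>x y. x * cnj y)"
proof
  show "x * cnj x = of_real ((norm x)\<^sup>2)" for x :: complex
    by (simp only: complex_norm_square)
qed (simp_all add: algebra_simps scnj_complex_def scaleR_conv_of_real)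

text \<open>Summability is demanded explicitly, as \<open>infsum\<close> is \<open>0\<close> for divergent series.\<close>

definition frame_with_bounds ::
  "('a::banach \<Rightarrow> 'a \<Rightarrow> 'k::real_or_complex_field) \<Rightarrow> 'i set \<Rightarrow> ('i \<Rightarrow> 'a) \<Rightarrow> real \<Rightarrow> real \<Rightarrow> bool"
  where "frame_with_bounds ip I \<phi> A B \<longleftrightarrow> A > 0 \<and> B > 0 \<and>
    (\<forall>f. (\<lambda>i. (norm (ip f (\<phi> i)))\<^sup>2) summable_on I \<and>
         A * (norm f)\<^sup>2 \<le> (\<Sum>\<^sub>\<infinity>i\<in>I. (norm (ip f (\<phi> i)))\<^sup>2) \<and>
         (\<Sum>\<^sub>\<infinity>i\<in>I. (norm (ip f (\<phi> i)))\<^sup>2) \<le> B * (norm f)\<^sup>2)"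

definition is_frame ::
  "('a::banach \<Rightarrow> 'a \<Rightarrow> 'k::real_or_complex_field) \<Rightarrow> 'i set \<Rightarrow> ('i \<Rightarrow> 'a) \<Rightarrow> bool"
  where "is_frame ip I \<phi> \<longleftrightarrow> (\<exists>A B. frame_with_bounds ip I \<phi> A B)"

text \<open>
  The union of the two subfamilies is a union of indexed families, so repeated vectors count with
  multiplicity: it is the family over \<open>I\<close> equal to \<open>\<phi>\<close> on \<open>\<sigma>\<close> and to \<open>\<psi>\<close> on \<open>I - \<sigma>\<close>.
\<close>

definition weaving :: "('i \<Rightarrow> 'a) \<Rightarrow> ('i \<Rightarrow> 'a) \<Rightarrow> 'i set \<Rightarrow> 'i \<Rightarrow> 'a"
  where "weaving \<phi> \<psi> \<sigma> i = (if i \<in> \<sigma> then \<phi> i else \<psi> i)"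

definition woven_frames ::
  "('a::banach \<Rightarrow> 'a \<Rightarrow> 'k::real_or_complex_field) \<Rightarrow> 'i set \<Rightarrow> ('i \<Rightarrow> 'a) \<Rightarrow> ('i \<Rightarrow> 'a) \<Rightarrow> bool"
  where "woven_frames ip I \<phi> \<psi> \<longleftrightarrow> is_frame ip I \<phi> \<and> is_frame ip I \<psi> \<and>
    (\<exists>A B. \<forall>\<sigma>\<subseteq>I. frame_with_bounds ip I (weaving \<phi> \<psi> \<sigma>) A B)"

text \<open>For a subfamily of a frame the series converges unconditionally, hence as an \<open>infsum\<close>.\<close>

definition partial_frame_op ::
  "('k::real_or_complex_field \<Rightarrow> 'a::banach \<Rightarrow> 'a) \<Rightarrow> ('a \<Rightarrow> 'a \<Rightarrow> 'k) \<Rightarrow> ('i \<Rightarrow> 'a) \<Rightarrow> 'i set \<Rightarrow> 'a \<Rightarrow> 'a"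
  where "partial_frame_op smul ip \<phi> J f = (\<Sum>\<^sub>\<infinity>i\<in>J. smul (ip f (\<phi> i)) (\<phi> i))"

definition weaving_frame_op ::
  "('k::real_or_complex_field \<Rightarrow> 'a::banach \<Rightarrow> 'a) \<Rightarrow> ('a \<Rightarrow> 'a \<Rightarrow> 'k) \<Rightarrow>
    'i set \<Rightarrow> ('i \<Rightarrow> 'a) \<Rightarrow> ('i \<Rightarrow> 'a) \<Rightarrow> 'i set \<Rightarrow> 'a \<Rightarrow> 'a"
  where "weaving_frame_op smul ip I \<phi> \<psi> \<sigma> f =
    partial_frame_op smul ip \<phi> \<sigma> f + partial_frame_op smul ip \<psi> (I - \<sigma>) f"

end

theory Submission
  imports Defs
begin

text \<open>
  A weaving is a single frame \<open>w\<close> with bijective self-adjoint frame operator \<open>S\<close>, the sum of the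
  operators \<open>S\<^sub>1\<close> and \<open>S\<^sub>2\<close> of its two subfamilies. Put \<open>u = S\<^sup>-\<^sup>1 S\<^sub>1 f\<close>, \<open>v = S\<^sup>-\<^sup>1 S\<^sub>2 f\<close>, so \<open>f = u + v\<close>.
  Both sides of the identity equal \<open>\<langle>S u, u\<rangle> + \<langle>S u, v\<rangle> + \<langle>S v, v\<rangle>\<close>, where \<open>\<langle>S u, v\<rangle>\<close> is real because
  \<open>\<langle>S u, f\<rangle> = \<langle>S\<^sub>1 f, f\<rangle>\<close> is. The difference of the two sides of the inequality is \<open>\<langle>S z, z\<rangle> \<ge> 0\<close> for
  \<open>z = (1 - \<lambda>/2) u - (\<lambda>/2) v\<close>.
\<close>

section \<open>Conjugation on the scalar field\<close>

lemma scnj_of_real [simp]: "scnj (of_real r :: 'k::real_or_complex_field) = of_real r"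
proof (cases "r = 0")
  case True
  have "scnj (0 + 0 :: 'k) = scnj 0 + scnj 0"
    by (rule scnj_add)
  with True show ?thesis by simp
next
  case False
  have "of_real r * scnj (of_real r :: 'k) = of_real r * of_real r"
    by (simp add: mult_scnj scaleR_conv_of_real power2_eq_square)
  with False show ?thesis by simp
qed

text \<open>Both sides agree after multiplication by \<open>x * y\<close>, because the norm is
  multiplicative; cancelling \<open>x * y\<close> leaves only the zero case, where
  \<open>scnj 0 = 0\<close> suffices.\<close>

lemma scnj_mult: "scnj (x * y) = scnj x * scnj (y :: 'k::real_or_complex_field)"
proof (cases "x * y = 0")
  case True
  then show ?thesis
    using scnj_of_real[of 0, where 'k='k] by auto
next
  case False
  have "(x * y) * scnj (x * y) = (x * scnj x) * (y * scnj y)"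
    by (simp only: mult_scnj) (simp add: norm_mult power_mult_distrib)
  also have "\<dots> = (x * y) * (scnj x * scnj y)"
    by (simp add: algebra_simps)
  finally show ?thesis
    using False by simp
qed

lemma norm_scnj [simp]: "norm (scnj x) = norm (x :: 'k::real_or_complex_field)"
proof (cases "x = 0")
  case True
  then show ?thesis using scnj_of_real[of 0, where 'k='k] by simp
next
  case False
  have "norm (x * scnj x) = (norm x)\<^sup>2"
    by (simp add: mult_scnj)
  then show ?thesis
    using False by (simp add: norm_mult power2_eq_square)
qed

lemma bounded_linear_scnj: "bounded_linear (scnj :: 'k::real_or_complex_field \<Rightarrow> 'k)"
  by (rule bounded_linear_intro[where K=1])
    (simp_all add: scnj_add scnj_mult scaleR_conv_of_real)

section \<open>Unconditional convergence from square bounds on finite sums\<close>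

text \<open>A Cauchy criterion for series that need not converge absolutely: finite sums of
  \<open>a\<close> outside a large finite set are small, so the finite partial sums of
  \<open>f\<close> form a Cauchy net. The bound then passes to the limit.\<close>

lemma
  fixes f :: "'i \<Rightarrow> 'b::banach" and a :: "'i \<Rightarrow> real"
  assumes a: "a summable_on X" "\<And>i. i \<in> X \<Longrightarrow> 0 \<le> a i" and C: "0 \<le> C"
    and le: "\<And>F. finite F \<Longrightarrow> F \<subseteq> X \<Longrightarrow> (norm (sum f F))\<^sup>2 \<le> C * sum a F"
  shows summable_on_norm_sum_square_le: "f summable_on X"
    and norm_infsum_square_le: "(norm (infsum f X))\<^sup>2 \<le> C * infsum a X"
proof -
  have "\<exists>P. eventually P (finite_subsets_at_top X) \<and>
            (\<forall>F F'. P F \<and> P F' \<longrightarrow> dist (sum f F) (sum f F') < e)" if e: "e > 0" for e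
  proof -
    \<comment> \<open>Chosen so that \<open>(C + 1) * d\<close> is the square of \<open>e/2\<close>;
      using \<open>C + 1\<close> instead of \<open>C\<close> keeps the quotient meaningful for
      \<open>C = 0\<close>.\<close>
    define d where "d = (e/2)\<^sup>2 / (C + 1)"
    have d: "d > 0"
      using e C by (simp add: d_def)
    obtain F0 where F0: "finite F0" "F0 \<subseteq> X" "dist (sum a F0) (infsum a X) \<le> d / 2"
      using infsum_finite_approximation[of a X "d/2"] a d by auto
    have near: "dist (sum f F) (sum f F0) < e / 2" if F: "finite F" "F0 \<subseteq> F" "F \<subseteq> X" for F
    proof -
      have "sum a F \<le> infsum a X"
        using a F by (intro finite_sum_le_infsum) auto
      then have "sum a (F - F0) \<le> d / 2"
        unfolding sum_diff[OF F(1,2)] using F0(3) unfolding dist_real_def by linarith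
      have "(dist (sum f F) (sum f F0))\<^sup>2 = (norm (sum f (F - F0)))\<^sup>2"
        using F F0 by (simp add: sum_diff dist_norm)
      also have "\<dots> \<le> C * sum a (F - F0)"
        using F by (intro le) auto
      also have "\<dots> \<le> C * (d / 2)"
        using \<open>sum a (F - F0) \<le> d / 2\<close> C by (rule mult_left_mono)
      also have "\<dots> < (C + 1) * d"
        using C d by (simp add: algebra_simps add_nonneg_pos)
      also have "\<dots> = (e/2)\<^sup>2"
        using C by (simp add: d_def)
      finally show ?thesis
        by (rule power2_less_imp_less) (use e in simp)
    qed
    have "eventually (\<lambda>F. finite F \<and> F0 \<subseteq> F \<and> F \<subseteq> X) (finite_subsets_at_top X)"
      using F0 by (auto simp: eventually_finite_subsets_at_top)
    moreover have "\<forall>F F'. (finite F \<and> F0 \<subseteq> F \<and> F \<subseteq> X) \<and> (finite F' \<and> F0 \<subseteq> F' \<and> F' \<subseteq> X)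
        \<longrightarrow> dist (sum f F) (sum f F') < e"
    proof (intro allI impI)
      fix F F'
      assume that: "(finite F \<and> F0 \<subseteq> F \<and> F \<subseteq> X) \<and> (finite F' \<and> F0 \<subseteq> F' \<and> F' \<subseteq> X)"
      have "dist (sum f F) (sum f F0) < e / 2" "dist (sum f F') (sum f F0) < e / 2"
        using that near by blast+
      then show "dist (sum f F) (sum f F') < e"
        using dist_triangle2[of "sum f F" "sum f F'" "sum f F0"] by linarith
    qed
    ultimately show ?thesis by (intro exI conjI)
  qed
  then have "cauchy_filter (filtermap (sum f) (finite_subsets_at_top X))"
    by (simp add: cauchy_filter_metric_filtermap)
  moreover have "complete (UNIV::'b set)"
    by (rule complete_UNIV)
  ultimately obtain L' where "(sum f \<longlongrightarrow> L') (finite_subsets_at_top X)"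
    using complete_uniform[where S="UNIV :: 'b set"] by (force simp add: filterlim_def)
  then show summ: "f summable_on X"
    using summable_on_def has_sum_def by blast
  have "((\<lambda>F. (norm (sum f F))\<^sup>2) \<longlongrightarrow> (norm (infsum f X))\<^sup>2) (finite_subsets_at_top X)"
    using has_sum_infsum[OF summ] by (auto simp: has_sum_def intro!: tendsto_intros)
  then show "(norm (infsum f X))\<^sup>2 \<le> C * infsum a X"
  proof (rule tendsto_upperbound)
    show "\<forall>\<^sub>F F in finite_subsets_at_top X. (norm (sum f F))\<^sup>2 \<le> C * infsum a X"
    proof (rule eventually_finite_subsets_at_top_weakI)
      fix F assume F: "finite F" "F \<subseteq> X"
      have "sum a F \<le> infsum a X"
        using a F by (intro finite_sum_le_infsum) auto
      then show "(norm (sum f F))\<^sup>2 \<le> C * infsum a X"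
        using le[OF F] C by (meson mult_left_mono order_trans)
    qed
  qed simp
qed

section \<open>Inner product calculus and the Cauchy-Schwarz inequality\<close>

context hilbert_space
begin

lemma ip_add_right: "ip x (y + z) = ip x y + ip x z"
  by (metis ip_commute ip_add_left scnj_add)

lemma ip_smul_right: "ip x (smul c y) = scnj c * ip x y"
  by (metis ip_commute ip_smul_left scnj_mult)

lemma ip_scaleR_left: "ip (r *\<^sub>R x) y = of_real r * ip x y"
  by (metis ip_smul_left smul_of_real)

lemma ip_scaleR_right: "ip x (r *\<^sub>R y) = of_real r * ip x y"
  by (metis ip_smul_right smul_of_real scnj_of_real)

lemma ip_diff_left: "ip (x - y) z = ip x z - ip y z"
  by (metis ip_add_left add_diff_cancel diff_add_cancel)

lemma ip_diff_right: "ip x (y - z) = ip x y - ip x z"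
  by (metis ip_add_right add_diff_cancel diff_add_cancel)

lemma ip_zero_left [simp]: "ip 0 y = 0"
  using ip_diff_left[of y y y] by simp

lemma ip_zero_right [simp]: "ip x 0 = 0"
  using ip_diff_right[of x x x] by simp

lemma ip_sum_left: "ip (sum g F) z = (\<Sum>i\<in>F. ip (g i) z)"
  by (induction F rule: infinite_finite_induct) (simp_all add: ip_add_left)

lemma norm_ip_commute: "norm (ip x y) = norm (ip y x)"
  by (metis ip_commute norm_scnj)

lemma ip_eqI:
  assumes "\<And>z. ip x z = ip y z"
  shows "x = y"
proof -
  have "ip (x - y) (x - y) = 0"
    using assms by (simp add: ip_diff_left)
  then show ?thesis by (simp add: ip_norm)
qed

lemma cauchy_schwarz: "norm (ip x y) \<le> norm x * norm y"
proof (cases "y = 0")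
  case False
  define p q where "p = (norm y)\<^sup>2" and "q = ip x y"
  \<comment> \<open>This is the component of \<open>x\<close> orthogonal to \<open>y\<close>, scaled
    by the squared norm of \<open>y\<close> to avoid a division.\<close>
  define z where "z = p *\<^sub>R x - smul q y"
  have q: "ip x y = q" "ip y x = scnj q"
    by (simp_all add: q_def ip_commute[of y x])
  \<comment> \<open>The terms are grouped so that the last one vanishes by
    \<open>ip y y = of_real p\<close>.\<close>
  have "ip z z = of_real p * (of_real p * ip x x - q * scnj q) - q * scnj q * (of_real p - ip y y)"
    by (simp add: z_def ip_diff_left ip_diff_right ip_smul_left ip_smul_right ip_scaleR_left
        ip_scaleR_right q algebra_simps)
  also have "\<dots> = of_real (p * (p * (norm x)\<^sup>2 - (norm q)\<^sup>2))"
    by (simp add: ip_norm mult_scnj scaleR_conv_of_real p_def)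
  finally have "(norm z)\<^sup>2 = p * (p * (norm x)\<^sup>2 - (norm q)\<^sup>2)"
    by (simp only: ip_norm of_real_eq_iff)
  moreover have "p > 0"
    using False by (simp add: p_def)
  ultimately have "(norm q)\<^sup>2 \<le> p * (norm x)\<^sup>2"
    using zero_le_power2[of "norm z"] by (simp add: zero_le_mult_iff)
  then have "(norm q)\<^sup>2 \<le> (norm x * norm y)\<^sup>2"
    by (simp add: p_def power_mult_distrib mult.commute)
  then show ?thesis
    unfolding q_def by (rule power2_le_imp_le) simp
qed simp

lemma bounded_linear_ip_left: "bounded_linear (\<lambda>x. ip x y)"
  by (rule bounded_linear_intro[where K="norm y"])
    (simp_all add: ip_add_left ip_scaleR_left scaleR_conv_of_real cauchy_schwarz)

end

section \<open>Bessel families and their partial frame operators\<close>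

text \<open>The upper bound alone gives convergence, boundedness and self-adjointness of the
  operator of every subfamily; the lower bound enters only for invertibility.\<close>

locale bessel_family = hilbert_space smul ip
  for smul :: "'k::real_or_complex_field \<Rightarrow> 'a::banach \<Rightarrow> 'a" and ip +
  fixes I :: "'i set" and w :: "'i \<Rightarrow> 'a" and B :: real
  assumes B_nonneg: "0 \<le> B"
    and coeff_summable: "(\<lambda>i. (norm (ip f (w i)))\<^sup>2) summable_on I"
    and coeff_le: "(\<Sum>\<^sub>\<infinity>i\<in>I. (norm (ip f (w i)))\<^sup>2) \<le> B * (norm f)\<^sup>2"
begin

abbreviation S where "S \<equiv> partial_frame_op smul ip w"

lemma coeff_summable_subset: "J \<subseteq> I \<Longrightarrow> (\<lambda>i. (norm (ip f (w i)))\<^sup>2) summable_on J"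
  using coeff_summable summable_on_subset_banach by blast

lemma coeff_le_subset:
  assumes "J \<subseteq> I"
  shows "(\<Sum>\<^sub>\<infinity>i\<in>J. (norm (ip f (w i)))\<^sup>2) \<le> B * (norm f)\<^sup>2"
proof -
  have "(\<Sum>\<^sub>\<infinity>i\<in>J. (norm (ip f (w i)))\<^sup>2) \<le> (\<Sum>\<^sub>\<infinity>i\<in>I. (norm (ip f (w i)))\<^sup>2)"
    using assms by (intro infsum_mono_neutral coeff_summable_subset) auto
  then show ?thesis using coeff_le[of f] by simp
qed

text \<open>Synthesis is adjoint to analysis and so inherits its bound: pair the sum
  \<open>g\<close> with itself, apply Cauchy-Schwarz to the coefficients and the Bessel bound to
  \<open>g\<close>, and cancel the squared norm of \<open>g\<close>.\<close>

lemma norm_synthesis_le: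
  assumes "finite F" "F \<subseteq> I"
  shows "(norm (\<Sum>i\<in>F. smul (c i) (w i)))\<^sup>2 \<le> B * (\<Sum>i\<in>F. (norm (c i))\<^sup>2)"
proof -
  define g where "g = (\<Sum>i\<in>F. smul (c i) (w i))"
  have "(norm g)\<^sup>2 = norm (ip g g)"
    by (simp add: ip_norm norm_power)
  also have "ip g g = (\<Sum>i\<in>F. c i * ip (w i) g)"
    by (subst (1) g_def) (simp add: ip_sum_left ip_smul_left)
  also have "norm \<dots> \<le> (\<Sum>i\<in>F. norm (c i) * norm (ip g (w i)))"
    by (rule sum_norm_le) (simp add: norm_mult norm_ip_commute)
  finally have "((norm g)\<^sup>2)\<^sup>2 \<le> (\<Sum>i\<in>F. norm (c i) * norm (ip g (w i)))\<^sup>2"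
    by (intro power_mono) auto
  also have "\<dots> \<le> (\<Sum>i\<in>F. (norm (c i))\<^sup>2) * (\<Sum>i\<in>F. (norm (ip g (w i)))\<^sup>2)"
    by (rule Cauchy_Schwarz_ineq_sum)
  also have "\<dots> \<le> (\<Sum>i\<in>F. (norm (c i))\<^sup>2) * (B * (norm g)\<^sup>2)"
    using coeff_le_subset[OF assms(2), of g] assms
    by (intro mult_left_mono) (auto intro: sum_nonneg)
  finally have "(norm g)\<^sup>2 * (norm g)\<^sup>2 \<le> (B * (\<Sum>i\<in>F. (norm (c i))\<^sup>2)) * (norm g)\<^sup>2"
    by (simp add: power2_eq_square mult_ac)
  then have "(norm g)\<^sup>2 \<le> B * (\<Sum>i\<in>F. (norm (c i))\<^sup>2)" if "g \<noteq> 0"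
    by (rule mult_right_le_imp_le) (use that in simp)
  then show ?thesis
    unfolding g_def[symmetric] by (cases "g = 0") (auto simp: B_nonneg sum_nonneg)
qed

text \<open>The coefficients of \<open>f\<close> itself are fed into the synthesis bound, with
  \<open>C = B\<close> in the convergence criterion; a second use of the Bessel bound gives the
  operator norm.\<close>

lemma
  assumes J: "J \<subseteq> I"
  shows frame_series_summable: "(\<lambda>i. smul (ip f (w i)) (w i)) summable_on J"
    and norm_S_le: "norm (S J f) \<le> B * norm f"
proof -
  have le: "(norm (\<Sum>i\<in>F. smul (ip f (w i)) (w i)))\<^sup>2 \<le> B * (\<Sum>i\<in>F. (norm (ip f (w i)))\<^sup>2)"
    if "finite F" "F \<subseteq> J" for F
    using that J by (intro norm_synthesis_le) auto
  show "(\<lambda>i. smul (ip f (w i)) (w i)) summable_on J"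
    by (rule summable_on_norm_sum_square_le[OF coeff_summable_subset[OF J] _ B_nonneg le]) auto
  have "(norm (S J f))\<^sup>2 \<le> B * (\<Sum>\<^sub>\<infinity>i\<in>J. (norm (ip f (w i)))\<^sup>2)"
    unfolding partial_frame_op_def
    by (rule norm_infsum_square_le[OF coeff_summable_subset[OF J] _ B_nonneg le]) auto
  also have "\<dots> \<le> B * (B * (norm f)\<^sup>2)"
    by (intro mult_left_mono coeff_le_subset J B_nonneg)
  also have "\<dots> = (B * norm f)\<^sup>2"
    by (simp add: power2_eq_square)
  finally show "norm (S J f) \<le> B * norm f"
    by (rule power2_le_imp_le) (simp add: B_nonneg)
qed

lemma S_has_sum: "J \<subseteq> I \<Longrightarrow> ((\<lambda>i. smul (ip f (w i)) (w i)) has_sum S J f) J"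
  unfolding partial_frame_op_def by (intro has_sum_infsum frame_series_summable)

lemma ip_S_has_sum:
  assumes "J \<subseteq> I"
  shows "((\<lambda>i. ip f (w i) * ip (w i) g) has_sum ip (S J f) g) J"
  using has_sum_bounded_linear[OF bounded_linear_ip_left S_has_sum[OF assms]]
  by (simp add: ip_smul_left)

lemma ip_S_self:
  assumes "J \<subseteq> I"
  shows "ip (S J f) f = of_real (\<Sum>\<^sub>\<infinity>i\<in>J. (norm (ip f (w i)))\<^sup>2)"
proof -
  have "((\<lambda>i. of_real ((norm (ip f (w i)))\<^sup>2)) has_sum ip (S J f) f) J"
    using ip_S_has_sum[OF assms, of f f]
    by (simp add: ip_commute[of "w _" f] mult_scnj scaleR_conv_of_real)
  moreover have "((\<lambda>i. of_real ((norm (ip f (w i)))\<^sup>2) :: 'k) has_sum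
      of_real (\<Sum>\<^sub>\<infinity>i\<in>J. (norm (ip f (w i)))\<^sup>2)) J"
    using has_sum_infsum[OF coeff_summable_subset[OF assms]]
    by (rule has_sum_bounded_linear[OF bounded_linear_of_real])
  ultimately show ?thesis
    by (rule has_sum_unique)
qed

text \<open>Conjugating the series of \<open>ip (S J g) f\<close> term by term turns it into the
  series of \<open>ip (S J f) g\<close>.\<close>

lemma S_self_adjoint:
  assumes "J \<subseteq> I"
  shows "ip (S J f) g = ip f (S J g)"
proof -
  have "((\<lambda>i. scnj (ip g (w i) * ip (w i) f)) has_sum scnj (ip (S J g) f)) J"
    by (rule has_sum_bounded_linear[OF bounded_linear_scnj ip_S_has_sum[OF assms]])
  then have "((\<lambda>i. ip f (w i) * ip (w i) g) has_sum ip f (S J g)) J"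
    by (simp add: scnj_mult ip_commute[symmetric] mult.commute)
  then show ?thesis
    using ip_S_has_sum[OF assms] has_sum_unique by blast
qed

text \<open>Self-adjointness moves the operator to the test vector, so linearity follows from that
  of \<open>ip\<close> without manipulating series; the same holds for differences and real
  multiples.\<close>

lemma S_add: "J \<subseteq> I \<Longrightarrow> S J (x + y) = S J x + S J y"
  by (rule ip_eqI) (simp add: S_self_adjoint ip_add_left)

lemma S_diff: "J \<subseteq> I \<Longrightarrow> S J (x - y) = S J x - S J y"
  by (rule ip_eqI) (simp add: S_self_adjoint ip_diff_left)

lemma S_scaleR: "J \<subseteq> I \<Longrightarrow> S J (r *\<^sub>R x) = r *\<^sub>R S J x"
  by (rule ip_eqI) (simp add: S_self_adjoint ip_scaleR_left)

lemma S_Un: "J \<subseteq> I \<Longrightarrow> K \<subseteq> I \<Longrightarrow> J \<inter> K = {} \<Longrightarrow> S (J \<union> K) f = S J f + S K f"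
  unfolding partial_frame_op_def by (intro infsum_Un_disjoint frame_series_summable)

end

section \<open>Invertibility of the frame operator, and the identity and inequality for one
  frame\<close>

locale frame_family = bessel_family smul ip I w B
  for smul :: "'k::real_or_complex_field \<Rightarrow> 'a::banach \<Rightarrow> 'a" and ip
    and I :: "'i set" and w B +
  fixes A :: real
  assumes A_pos: "0 < A" and B_pos: "0 < B"
    and coeff_ge: "A * (norm f)\<^sup>2 \<le> (\<Sum>\<^sub>\<infinity>i\<in>I. (norm (ip f (w i)))\<^sup>2)"
begin

text \<open>Since \<open>A * (norm g)\<^sup>2 \<le> ip (S I g) g\<close> and \<open>norm (S I g) \<le> B * norm g\<close>, the map
  \<open>g \<mapsto> g - t *\<^sub>R (S I g - h)\<close> with \<open>t = A / B\<^sup>2\<close> contracts by the factor \<open>sqrt (1 - A\<^sup>2 / B\<^sup>2)\<close>;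
  its fixed point is the preimage of \<open>h\<close>.\<close>

lemma bij_S: "bij (S I)"
proof -
  \<comment> \<open>This \<open>t\<close> minimizes \<open>1 - 2 * t * A + t^2 * B^2\<close>. On the
    zero space \<open>A > B\<close> is possible, so \<open>max 0\<close> keeps the root
    nonnegative.\<close>
  define t c where "t = A / B\<^sup>2" and "c = sqrt (max 0 (1 - A\<^sup>2 / B\<^sup>2))"
  have contr: "norm (g - t *\<^sub>R S I g) \<le> c * norm g" for g
  proof -
    define e where "e = (\<Sum>\<^sub>\<infinity>i\<in>I. (norm (ip g (w i)))\<^sup>2)"
    have e: "ip (S I g) g = of_real e" "ip g (S I g) = of_real e"
      by (simp_all add: e_def ip_S_self S_self_adjoint[symmetric])
    have "ip (g - t *\<^sub>R S I g) (g - t *\<^sub>R S I g)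
        = of_real ((norm g)\<^sup>2 - 2 * t * e + t\<^sup>2 * (norm (S I g))\<^sup>2)"
      by (simp add: ip_diff_left ip_diff_right ip_scaleR_left ip_scaleR_right e ip_norm[of g]
          ip_norm[of "S I g"] algebra_simps power2_eq_square)
    then have "(norm (g - t *\<^sub>R S I g))\<^sup>2 = (norm g)\<^sup>2 - 2 * t * e + t\<^sup>2 * (norm (S I g))\<^sup>2"
      by (simp only: ip_norm of_real_eq_iff)
    also have "\<dots> \<le> (norm g)\<^sup>2 - 2 * t * (A * (norm g)\<^sup>2) + t\<^sup>2 * (B * norm g)\<^sup>2"
      using coeff_ge[of g] norm_S_le[of I g] A_pos B_pos
      by (intro add_mono diff_mono mult_left_mono power_mono) (auto simp: e_def t_def)
    also have "\<dots> = (1 - A\<^sup>2 / B\<^sup>2) * (norm g)\<^sup>2"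
      using B_pos by (simp add: t_def power_mult_distrib field_simps power2_eq_square)
    also have "\<dots> \<le> (c * norm g)\<^sup>2"
      by (simp add: c_def power_mult_distrib mult_right_mono)
    finally show ?thesis
      by (rule power2_le_imp_le) (simp add: c_def)
  qed
  have c: "0 \<le> c" "c < 1"
    using A_pos B_pos by (auto simp: c_def max_def)
  have t: "t \<noteq> 0"
    using A_pos B_pos by (simp add: t_def)
  have "\<exists>!g. g - t *\<^sub>R (S I g - h) = g" for h
  proof (rule banach_fix_type[OF c], intro allI)
    fix x y
    have "(x - t *\<^sub>R (S I x - h)) - (y - t *\<^sub>R (S I y - h)) = (x - y) - t *\<^sub>R S I (x - y)"
      by (simp add: S_diff algebra_simps)
    then show "dist (x - t *\<^sub>R (S I x - h)) (y - t *\<^sub>R (S I y - h)) \<le> c * dist x y"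
      using contr[of "x - y"] by (simp only: dist_norm)
  qed
  then have "\<exists>!g. S I g = h" for h
    using t by simp
  then show ?thesis
    by (simp add: bij_iff)
qed

lemma S_inv [simp]: "S I (inv (S I) g) = g"
  by (simp add: bij_S bij_is_surj surj_f_inv_f)

lemma ip_inv_S: "ip (inv (S I) g) h = ip g (inv (S I) h)"
  using S_self_adjoint[of I "inv (S I) g" "inv (S I) h"] by simp

lemma
  fixes l :: real and f :: 'a
  assumes J: "J \<subseteq> I"
  defines "E \<equiv> \<lambda>g. \<Sum>\<^sub>\<infinity>i\<in>I. (norm (ip g (inv (S I) (w i))))\<^sup>2"
    and "a \<equiv> \<Sum>\<^sub>\<infinity>i\<in>J. (norm (ip f (w i)))\<^sup>2"
    and "b \<equiv> \<Sum>\<^sub>\<infinity>i\<in>I - J. (norm (ip f (w i)))\<^sup>2"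
  shows frame_identity: "a + E (S (I - J) f) = b + E (S J f)"
    and frame_inequality: "(l - l\<^sup>2 / 4) * a + (1 - l\<^sup>2 / 4) * b \<le> b + E (S J f)"
proof -
  define Q where "Q g = (\<Sum>\<^sub>\<infinity>i\<in>I. (norm (ip g (w i)))\<^sup>2)" for g
  \<comment> \<open>Moving the self-adjoint inverse across \<open>ip\<close> turns the dual
    coefficients of \<open>g\<close> into ordinary coefficients of
    \<open>inv (S I) g\<close>.\<close>
  have E: "E g = Q (inv (S I) g)" for g
    by (simp add: E_def Q_def ip_inv_S)
  have Q: "ip (S I g) g = of_real (Q g)" for g
    by (simp add: Q_def ip_S_self)
  have Q_nonneg: "0 \<le> Q g" for g
    unfolding Q_def by (rule infsum_nonneg) simp
  define u v where "u = inv (S I) (S J f)" and "v = inv (S I) (S (I - J) f)"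
  have Su: "S I u = S J f" and Sv: "S I v = S (I - J) f"
    by (simp_all add: u_def v_def)
  have "S I (u + v) = S I f"
    using J S_Un[of J "I - J" f] by (simp add: S_add Su Sv Un_absorb1 Un_Diff_cancel)
  then have f: "f = u + v"
    using bij_S by (simp add: bij_is_inj inj_eq)
  \<comment> \<open>Since \<open>S I u = S J f\<close>, the number \<open>a\<close> is the form of
    \<open>S I u\<close> against \<open>u + v\<close>; this makes the cross term the real number
    \<open>a - Q u\<close>.\<close>
  have "of_real a = ip (S I u) (u + v)"
    using ip_S_self[OF J, of f] by (simp add: a_def Su f[symmetric])
  then have uv: "ip (S I u) v = of_real (a - Q u)"
    by (simp add: ip_add_right Q)
  have vu: "ip (S I v) u = of_real (a - Q u)"
    using arg_cong[OF uv, of scnj] by (simp only: ip_commute[symmetric] S_self_adjoint scnj_of_real order_refl)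
  have "of_real b = ip (S I v) (u + v)"
    using ip_S_self[of "I - J" f] by (simp add: b_def Sv f[symmetric])
  also have "\<dots> = of_real (a - Q u + Q v)"
    by (simp add: ip_add_right vu Q)
  finally have b: "b = a - Q u + Q v"
    by (simp only: of_real_eq_iff)
  then show "a + E (S (I - J) f) = b + E (S J f)"
    by (simp add: E u_def v_def)
  \<comment> \<open>As \<open>p + q = 1\<close> and \<open>f = u + v\<close>, the vector
    \<open>z\<close> is \<open>u - (l/2) f\<close>, whence
    \<open>Q z = Q u - l * a + (l^2/4) * (a + b)\<close>.\<close>
  define p q where "p = 1 - l / 2" and "q = l / 2"
  define z where "z = p *\<^sub>R u - q *\<^sub>R v"
  have "of_real (Q z) = ip (S I z) z"
    by (simp only: Q)
  also have "\<dots> = of_real (p\<^sup>2 * Q u - 2 * p * q * (a - Q u) + q\<^sup>2 * Q v)"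
    by (simp add: z_def S_diff S_scaleR ip_diff_left ip_diff_right ip_scaleR_left ip_scaleR_right
        Q uv vu algebra_simps power2_eq_square)
  finally have "Q z = p\<^sup>2 * Q u - 2 * p * q * (a - Q u) + q\<^sup>2 * Q v"
    by (simp only: of_real_eq_iff)
  also have "\<dots> = b + Q u - ((l - l\<^sup>2 / 4) * a + (1 - l\<^sup>2 / 4) * b)"
    by (simp add: b p_def q_def field_simps power2_eq_square)
  finally show "(l - l\<^sup>2 / 4) * a + (1 - l\<^sup>2 / 4) * b \<le> b + E (S J f)"
    using Q_nonneg[of z] by (simp add: E u_def)
qed

end

section \<open>Specialization to a weaving\<close>

theorem theorem7:
  fixes smul :: "'k::real_or_complex_field \<Rightarrow> 'a::banach \<Rightarrow> 'a"
    and ip :: "'a \<Rightarrow> 'a \<Rightarrow> 'k"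
    and I \<sigma> :: "'i set"
    and \<phi> \<psi> :: "'i \<Rightarrow> 'a"
    and l :: real
    and f :: 'a
  assumes "hilbert_space smul ip"
    and "separable_space (euclidean :: 'a topology)"
    and "countable I"
    and "woven_frames ip I \<phi> \<psi>"
    and "\<sigma> \<subseteq> I"
  shows "let S1 = partial_frame_op smul ip \<phi> \<sigma>;
             S2 = partial_frame_op smul ip \<psi> (I - \<sigma>);
             Sinv = inv (weaving_frame_op smul ip I \<phi> \<psi> \<sigma>);
             lhs = (\<Sum>\<^sub>\<infinity>i\<in>\<sigma>. (norm (ip f (\<phi> i)))\<^sup>2)
                 + (\<Sum>\<^sub>\<infinity>i\<in>\<sigma>. (norm (ip (S2 f) (Sinv (\<phi> i))))\<^sup>2)
                 + (\<Sum>\<^sub>\<infinity>i\<in>I - \<sigma>. (norm (ip (S2 f) (Sinv (\<psi> i))))\<^sup>2);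
             rhs = (\<Sum>\<^sub>\<infinity>i\<in>I - \<sigma>. (norm (ip f (\<psi> i)))\<^sup>2)
                 + (\<Sum>\<^sub>\<infinity>i\<in>\<sigma>. (norm (ip (S1 f) (Sinv (\<phi> i))))\<^sup>2)
                 + (\<Sum>\<^sub>\<infinity>i\<in>I - \<sigma>. (norm (ip (S1 f) (Sinv (\<psi> i))))\<^sup>2)
         in lhs = rhs \<and>
            rhs \<ge> (l - l\<^sup>2 / 4) * (\<Sum>\<^sub>\<infinity>i\<in>\<sigma>. (norm (ip f (\<phi> i)))\<^sup>2)
                 + (1 - l\<^sup>2 / 4) * (\<Sum>\<^sub>\<infinity>i\<in>I - \<sigma>. (norm (ip f (\<psi> i)))\<^sup>2)"
proof -
  interpret hilbert_space smul ip by fact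
  define w where "w = weaving \<phi> \<psi> \<sigma>"
  obtain A B where AB: "frame_with_bounds ip I w A B"
    using assms(4,5) unfolding woven_frames_def w_def by blast
  interpret frame_family smul ip I w B A
    using AB unfolding frame_with_bounds_def by unfold_locales auto
  have w: "w i = \<phi> i" if "i \<in> \<sigma>" for i
    using that by (simp add: w_def weaving_def)
  have w': "w i = \<psi> i" if "i \<in> I - \<sigma>" for i
    using that by (simp add: w_def weaving_def)
  have split: "infsum g I = infsum g \<sigma> + infsum g (I - \<sigma>)" if "g summable_on I" for g :: "'i \<Rightarrow> real"
    using infsum_Un_disjoint[of g \<sigma> "I - \<sigma>"] that \<open>\<sigma> \<subseteq> I\<close>
    by (simp add: Un_absorb1 summable_on_subset_banach)
  have S1: "partial_frame_op smul ip \<phi> \<sigma> = S \<sigma>"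
    unfolding partial_frame_op_def by (intro ext infsum_cong) (simp add: w)
  have S2: "partial_frame_op smul ip \<psi> (I - \<sigma>) = S (I - \<sigma>)"
    unfolding partial_frame_op_def by (intro ext infsum_cong) (simp add: w')
  have SW: "weaving_frame_op smul ip I \<phi> \<psi> \<sigma> = S I"
  proof
    show "weaving_frame_op smul ip I \<phi> \<psi> \<sigma> g = S I g" for g
      using S_Un[of \<sigma> "I - \<sigma>" g] \<open>\<sigma> \<subseteq> I\<close>
      by (simp add: weaving_frame_op_def S1 S2 Un_absorb1)
  qed
  \<comment> \<open>The function \<open>h\<close> is later taken to be the identity or the inverse
    frame operator, which covers all sums of the claim.\<close>
  have sums: "(\<Sum>\<^sub>\<infinity>i\<in>\<sigma>. (norm (ip g (h (\<phi> i))))\<^sup>2) = (\<Sum>\<^sub>\<infinity>i\<in>\<sigma>. (norm (ip g (h (w i))))\<^sup>2)"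
    "(\<Sum>\<^sub>\<infinity>i\<in>I - \<sigma>. (norm (ip g (h (\<psi> i))))\<^sup>2) = (\<Sum>\<^sub>\<infinity>i\<in>I - \<sigma>. (norm (ip g (h (w i))))\<^sup>2)" for g h
    by (auto intro!: infsum_cong simp: w w')
  \<comment> \<open>Splitting requires summability over \<open>I\<close>: the terms are the squared
    coefficients of \<open>inv (S I) g\<close> in the frame \<open>w\<close>.\<close>
  have E: "(\<Sum>\<^sub>\<infinity>i\<in>\<sigma>. (norm (ip g (inv (S I) (w i))))\<^sup>2)
      + (\<Sum>\<^sub>\<infinity>i\<in>I - \<sigma>. (norm (ip g (inv (S I) (w i))))\<^sup>2)
      = (\<Sum>\<^sub>\<infinity>i\<in>I. (norm (ip g (inv (S I) (w i))))\<^sup>2)" for g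
    by (rule split[symmetric]) (simp add: ip_inv_S[symmetric] coeff_summable)
  show ?thesis
    unfolding Let_def S1 S2 SW sums[where h="inv (S I)"] sums[where h="\<lambda>x. x"] add.assoc E
    using frame_identity[OF \<open>\<sigma> \<subseteq> I\<close>] frame_inequality[OF \<open>\<sigma> \<subseteq> I\<close>] by auto
qed

end
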